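(* Let $\{\mathcal{X}_k\}_{k\ge 0}$, $\mathcal{X}_k=(\boldsymbol{z}_k,\boldsymbol{\ell}_k)$, be the opinion-driven two-queue Markov chain with $N$ agents defined in the context, and assume $\mathcal{X}_0\notin\mathcal{N}$. Let $W_k$ denote the set of agents in the waiting pool at epoch $k$ and $n_W^k=|W_k|$. Suppose that: (i) there exists a constant $\zeta>0$ such that whenever $n_W^k>0$ there is at least one agent $i\in W_k$ with $|z_i^{k+1}|\ge\zeta$; (ii) there exists $\overline{m}>0$ such that $$\gamma_i b_{\#}\ \ge\ \omega_i(u_{0_i}+K)+\alpha_i\|\boldsymbol{A}\|_\infty+\overline{m}\qquad\text{for all agents } i;$$ (iii) for this $\overline m$, the decision interval duration satisfies $$\Delta t_D>\max_i\left\{\frac{1}{\lambda_i}\ln\left(\frac{\lambda_i+\tanh(\overline{m})}{\tanh(\overline{m})}\right)\right\};$$ (iv) there exists a constant $\psi\in(0,1)$ such that, whenever $\mathcal{X}_k\notin\mathcal{N}$ and $n_W^k=0$, one has $|z_i^{k+1}|\le\psi$ for all agents $i$ in the more expensive queue at epoch $k$ (the queue with more members). Then the Markov chain hits $\mathcal{N}$ in finite expected time, i.e. $\mathbb{E}\big[\inf\{k\ge 0:\mathcal{X}_k\in\mathcal{N}\}\big]<\infty$.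
   Context: There are $N$ agents, two queues $A$, $B$ and a waiting pool $W$. Agent $i$'s location at epoch $k$ is $\ell_i^k\in\{0,+1,-1\}$, where $0,+1,-1$ index $W,A,B$ respectively; its opinion is $z_i^k\in[-1,1]$. Write $\boldsymbol{\ell}_k=(\ell_1^k,\dots,\ell_N^k)$, $\boldsymbol{z}_k=(z_1^k,\dots,z_N^k)$; the state space is $\mathcal{S}=[-1,1]^N\times\{0,\pm1\}^N$. Let $n_A,n_B,n_W$ be the numbers of agents in $A,B,W$. Decision epochs $t_k$ are equally spaced with $t_{k+1}-t_k=\Delta t_D>0$. Let $b_k=\Delta Q_k=n_A-n_B$ be the signed queue imbalance at epoch $k$ (known exactly to all agents). Opinion update: on $[t_k,t_{k+1})$, starting from $z_i(t_k)=z_i^k$, the opinions solve $$\dot z_i=-\lambda_i z_i+\tanh\Big(\omega_i u_i z_i+\alpha_i\sum_{j=1,\,j\ne i}^N a_{ij}\hat z_j-\gamma_i b_k\Big),\qquad u_i=u_{0_i}+Kz_i^2,$$ with $b_k$ held constant on the interval, and $z_i^{k+1}=z_i(t_{k+1}^-)$. Agents have complete information, so the estimates are exact: $\hat z_j=z_j$. Opinions are standing-assumed to satisfy $z_i(t)\in[-1,1]$ for all $t$. Parameters: $\lambda_i>0$, $\omega_i\ge0$, $\alpha_i\ge0$, $K\ge0$, $u_{0_i}\in\mathbb{R}$, $\gamma_i\in\mathbb{R}$, $\boldsymbol{A}=[a_{ij}]$ with $a_{ij}\in\{0,\pm1\}$, and $\|\boldsymbol{A}\|_\infty=\max_i\sum_j|a_{ij}|$.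 Location update: just before $t_{k+1}$ each agent independently draws $U_i^k\sim\mathrm{Unif}(0,1)$ (independent across agents and epochs). If $\ell_i^k=0$, then agent $i$ joins a queue iff $U_i^k\le|z_i^{k+1}|$, and the queue joined is the one with index $\operatorname{sgn}(z_i^{k+1})$; otherwise it stays in $W$. If $\ell_i^k\in\{\pm1\}$, agent $i$ switches to the other queue iff $U_i^k\le|z_i^{k+1}|\,\mathbf{1}_{\{\operatorname{sgn}(z_i^{k+1})\ne\ell_i^k\}}$; otherwise it stays. No agent re-enters $W$. The resulting locations are $\boldsymbol{\ell}_{k+1}$, which determine $b_{k+1}$. Let $\Delta Q_*=0$ if $N$ is even and $\Delta Q_*=1$ if $N$ is odd. The Nash configuration band is $\mathcal{N}=\{\mathcal{X}\in\mathcal{S}: n_W=0\text{ and }|n_A-n_B|\le\Delta Q_*\}$. The constant $b_{\#}$ equals $2$.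
   Formalization: The formal theorem also assumes γ_i b_# ≥ α_i‖A‖_∞ + m̄ for all i. This follows from (ii) when ω_i(u_{0i}+K) ≥ 0; for negative values the claim as stated can fail (e.g. N=2, K=α=0, ω=λ=1, u_0=−10, γ=−4.9, m̄=0.2, Δt_D=2). *)

theory Defs
  imports "HOL-Probability.Probability"
begin

text \<open>
  Agents are the elements of a finite type \<open>'n\<close>, so that \<open>N = CARD('n)\<close>.
  The fields below are, in order, \<open>\<lambda>\<close>, \<open>\<omega>\<close>, \<open>\<alpha>\<close>, \<open>\<gamma>\<close>, \<open>u\<^sub>0\<close>, \<open>K\<close>, \<open>A\<close> and \<open>\<Delta>t\<^sub>D\<close>.
\<close>

record 'n params =
  damping :: "'n \<Rightarrow> real"
  self_gain :: "'n \<Rightarrow> real"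
  social_gain :: "'n \<Rightarrow> real"
  queue_gain :: "'n \<Rightarrow> real"
  base_attention :: "'n \<Rightarrow> real"
  attention_gain :: real
  adjacency :: "'n \<Rightarrow> 'n \<Rightarrow> real"
  interval :: real

definition valid_params :: "('n::finite) params \<Rightarrow> bool" where
  "valid_params P \<longleftrightarrow>
     (\<forall>i. damping P i > 0) \<and> (\<forall>i. self_gain P i \<ge> 0) \<and> (\<forall>i. social_gain P i \<ge> 0) \<and>
     attention_gain P \<ge> 0 \<and> (\<forall>i j. adjacency P i j \<in> {0, 1, -1}) \<and> interval P > 0"

definition matrix_norm_inf :: "('n::finite \<Rightarrow> 'n \<Rightarrow> real) \<Rightarrow> real" where
  "matrix_norm_inf A = (MAX i. \<Sum>j\<in>UNIV. \<bar>A i j\<bar>)"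

definition b_sharp :: real where
  "b_sharp = 2"


text \<open>Locations are \<open>0\<close> for the waiting pool, \<open>1\<close> for queue \<open>A\<close> and \<open>-1\<close> for queue \<open>B\<close>.\<close>

definition pool :: "('n \<Rightarrow> int) \<Rightarrow> 'n set" where
  "pool l = {i. l i = 0}"

definition queue_A :: "('n \<Rightarrow> int) \<Rightarrow> 'n set" where
  "queue_A l = {i. l i = 1}"

definition queue_B :: "('n \<Rightarrow> int) \<Rightarrow> 'n set" where
  "queue_B l = {i. l i = -1}"

definition imbalance :: "('n::finite \<Rightarrow> int) \<Rightarrow> int" where
  "imbalance l = int (card (queue_A l)) - int (card (queue_B l))"

definition expensive_queue :: "('n::finite \<Rightarrow> int) \<Rightarrow> 'n set" where
  "expensive_queue l =
     (if card (queue_A l) > card (queue_B l) then queue_A l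
      else if card (queue_B l) > card (queue_A l) then queue_B l
      else {})"

definition state_space :: "((real^'n::finite) \<times> ('n \<Rightarrow> int)) set" where
  "state_space = {(z, l). (\<forall>i. z $ i \<in> {-1..1}) \<and> (\<forall>i. l i \<in> {0, 1, -1})}"

definition nash_tolerance :: "nat \<Rightarrow> int" where
  "nash_tolerance N = (if even N then 0 else 1)"

definition nash_band :: "((real^'n::finite) \<times> ('n \<Rightarrow> int)) set" where
  "nash_band = {(z, l). (z, l) \<in> state_space \<and> card (pool l) = 0 \<and>
                  \<bar>imbalance l\<bar> \<le> nash_tolerance CARD('n)}"


definition opinion_drift :: "'n params \<Rightarrow> real \<Rightarrow> real^'n \<Rightarrow> real^('n::finite)" where
  "opinion_drift P b z = (\<chi> i. - damping P i * z $ i +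
     tanh (self_gain P i * (base_attention P i + attention_gain P * (z $ i)\<^sup>2) * z $ i
           + social_gain P i * (\<Sum>j\<in>UNIV - {i}. adjacency P i j * z $ j)
           - queue_gain P i * b))"

text \<open>
  The system is autonomous, so time is measured from the start \<open>t\<^sub>k\<close> of the interval.
  The last conjunct is the standing assumption that opinions remain in \<open>[-1, 1]\<close>.
\<close>

definition opinion_step :: "('n::finite) params \<Rightarrow> real \<Rightarrow> real^'n \<Rightarrow> real^'n \<Rightarrow> bool" where
  "opinion_step P b z z' \<longleftrightarrow> (\<exists>x :: real \<Rightarrow> real^'n.
     x 0 = z \<and>
     (\<forall>t\<in>{0..<interval P}.
        (x has_vector_derivative opinion_drift P b (x t)) (at t within {0..<interval P})) \<and>
     (x \<longlongrightarrow> z') (at_left (interval P)) \<and>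
     (\<forall>t\<in>{0..<interval P}. \<forall>i. x t $ i \<in> {-1..1}))"

text \<open>
  Here \<open>u\<close> is the uniform draw, \<open>x\<close> the new opinion and \<open>l\<close> the old location.
  The floor only converts the value \<open>sgn x\<close> from \<open>real\<close> to \<open>int\<close>.
\<close>

definition next_location :: "real \<Rightarrow> real \<Rightarrow> int \<Rightarrow> int" where
  "next_location u x l =
     (if l = 0 then (if u \<le> \<bar>x\<bar> then \<lfloor>sgn x\<rfloor> else l)
      else (if u \<le> \<bar>x\<bar> * (if sgn x \<noteq> real_of_int l then 1 else 0) then - l else l))"

text \<open>
  The initial state may be random; it is then independent of all draws.
  A deterministic initial state is the special case of a constant \<open>X 0\<close>.
\<close>

locale queue_chain = prob_space M for M :: "'w measure" +
  fixes P :: "('n::finite) params"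
    and U :: "nat \<Rightarrow> 'n \<Rightarrow> 'w \<Rightarrow> real"
    and X :: "nat \<Rightarrow> 'w \<Rightarrow> (real^'n) \<times> ('n \<Rightarrow> int)"
  assumes measurable_state: "X k \<in> M \<rightarrow>\<^sub>M borel \<Otimes>\<^sub>M count_space UNIV"
    and in_state_space: "\<omega> \<in> space M \<Longrightarrow> X k \<omega> \<in> state_space"
    and uniform_draws: "distr M borel (U k i) = uniform_measure lborel {0<..<1}"
    and indep_draws: "indep_vars (\<lambda>_. borel) (\<lambda>(k, i). U k i) UNIV"
    and indep_initial: "indep_set
          (sets (vimage_algebra (space M) (X 0) (borel \<Otimes>\<^sub>M count_space UNIV)))
          (sets (vimage_algebra (space M) (\<lambda>\<omega> (k, i). U k i \<omega>)
             (Pi\<^sub>M (UNIV :: (nat \<times> 'n) set) (\<lambda>_. borel))))"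
    and opinion_update: "\<omega> \<in> space M \<Longrightarrow>
          opinion_step P (real_of_int (imbalance (snd (X k \<omega>))))
            (fst (X k \<omega>)) (fst (X (Suc k) \<omega>))"
    and location_update: "\<omega> \<in> space M \<Longrightarrow>
          snd (X (Suc k) \<omega>) i =
            next_location (U k i \<omega>) (fst (X (Suc k) \<omega>) $ i) (snd (X k \<omega>) i)"

text \<open>The hitting time is \<open>\<infinity>\<close> if the set is never reached.\<close>

definition hitting_time :: "(nat \<Rightarrow> 'w \<Rightarrow> 's) \<Rightarrow> 's set \<Rightarrow> 'w \<Rightarrow> ennreal" where
  "hitting_time X S \<omega> = (INF k\<in>{k. X k \<omega> \<in> S}. of_nat k)"

end

theory Submission
  imports Defs
begin

text \<open>
  There is a pattern for the draws of \<open>2 N\<close> consecutive epochs which, from any state, forces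
  the chain into the Nash band during these epochs.  The pattern restricts each draw to a fixed interval
  of positive length, so it occurs in each block of \<open>2 N\<close> epochs with a probability bounded away from
  zero, independently of the other blocks.  The number of blocks until it first occurs has a geometric
  tail, and therefore the hitting time has finite expectation.  Because the pattern mentions only the draws
  and is fixed in advance, the independence of the blocks is that of the draws; what the pattern does to
  a trajectory is a deterministic matter.

  In the first \<open>N\<close> epochs of a block all draws lie in \<open>(0, min \<zeta> 1]\<close>.  A nonempty pool contains an agent with
  opinion at least \<open>\<zeta>\<close> in modulus, which then joins a queue; so the pool empties (\<open>pool_emptied\<close>).

  In the next \<open>N\<close> epochs the agents take turns: the draw of the current agent lies in \<open>(0, \<eta>]\<close>, those
  of all others in \<open>(\<psi>, 1]\<close>.  By parity, outside the band the imbalance is at least \<open>2\<close> in modulus, and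
  then all opinions at the end of the interval favour the shorter queue by at least some constant
  \<open>\<eta> > 0\<close> (\<open>opinions_oppose_imbalance\<close>).  Hence the current agent switches if it is in the longer
  queue, while the others stay: those in the shorter queue because their opinion agrees with their
  location, those in the longer one because their opinion is at most \<open>\<psi>\<close> in modulus.  One round of this
  must reach the band (\<open>queues_balanced\<close>).

  The constant \<open>\<eta>\<close> comes from the differential equation.  Let \<open>z\<close> be an opinion, counted as positive
  towards the longer queue.  If the imbalance is at least \<open>2\<close> in modulus, the gain conditions give a
  drift of at most \<open>-\<lambda> z - tanh m\<close> wherever \<open>z \<ge> 0\<close>, and the duration is strictly longer than \<open>z\<close> can
  then take to fall from \<open>1\<close> to \<open>0\<close>.  By continuity the same holds for a slightly
  negative target level (\<open>barrier_level_exists\<close>), and this level is a barrier which is not crossed back (\<open>barrier_reached\<close>).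
\<close>

section \<open>Opinions at the end of an interval\<close>

text \<open>
  Once \<open>f\<close> is at or below the level \<open>-\<epsilon>\<close> it cannot rise above it, since the drift is negative
  at that level and higher.  As long as \<open>f\<close> stays above, it lies under the solution
  \<open>(1 + c) exp (-d t) - c\<close> of \<open>y' = -d (y + c)\<close>, \<open>y 0 = 1\<close>, and \<open>late\<close> says that this solution has
  come down to \<open>-\<epsilon>\<close> at time \<open>T\<close>.
\<close>

lemma barrier_reached:
  fixes f f' :: "real \<Rightarrow> real"
  assumes deriv: "\<And>t. t \<in> {0..<T} \<Longrightarrow> (f has_real_derivative f' t) (at t within {0..<T})"
    and drift: "\<And>t. t \<in> {0..<T} \<Longrightarrow> - \<epsilon> \<le> f t \<Longrightarrow> f' t \<le> - d * (f t + c)"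
    and "0 < T" "f 0 \<le> 1" "0 < d" "\<epsilon> < c"
    and late: "(1 + c) * exp (- d * T) - c \<le> - \<epsilon>"
    and lim: "(f \<longlongrightarrow> y) (at_left T)"
  shows "y \<le> - \<epsilon>"
proof -
  have cont: "continuous_on {a..b} f" if "0 \<le> a" "b < T" for a b
  proof (rule continuous_on_subset)
    show "continuous_on {0..<T} f"
      using deriv by (meson DERIV_continuous continuous_on_eq_continuous_within)
  qed (use that in auto)
  have deriv': "(f has_real_derivative f' t) (at t)" if "0 < t" "t < T" for t
    using deriv[of t] that at_within_interior[of t "{0..<T}"]
    by (auto simp: interior_atLeastLessThan)
  show ?thesis
  proof (cases "\<exists>t0\<in>{0..<T}. f t0 \<le> - \<epsilon>")
    case True
    then obtain t0 where t0: "0 \<le> t0" "t0 < T" "f t0 \<le> - \<epsilon>" by auto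
    have stays: "f t \<le> - \<epsilon>" if t: "t0 \<le> t" "t < T" for t
    proof (rule ccontr)
      assume above: "\<not> f t \<le> - \<epsilon>"
      let ?S = "{s \<in> {t0..t}. f s \<le> - \<epsilon>}"
      have "closed ?S"
        by (intro continuous_on_closed_Collect_le cont continuous_on_const) (use t0 t in auto)
      then have "compact ?S"
        using bounded_subset[OF bounded_closed_interval, of ?S t0 t]
        unfolding compact_eq_bounded_closed by blast
      moreover have "t0 \<in> ?S" using t0 t by auto
      ultimately obtain s where s: "s \<in> ?S" "\<And>r. r \<in> ?S \<Longrightarrow> r \<le> s"
        using compact_attains_sup[of ?S] by blast
      have st: "s < t" using s(1) above by (cases "s = t") auto
      have out: "- \<epsilon> < f r" if "s < r" "r \<le> t" for r
        using s(2)[of r] s(1) that by force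
      have "f t < f s"
      proof (rule DERIV_neg_imp_decreasing_open[OF st])
        fix r assume r: "s < r" "r < t"
        have "f' r \<le> - d * (f r + c)"
          using drift[of r] out[of r] r s(1) t0 t by auto
        also have "\<dots> < 0"
          using out[of r] r \<open>0 < d\<close> \<open>\<epsilon> < c\<close> by (simp add: mult_less_0_iff)
        finally show "\<exists>D. (f has_real_derivative D) (at r) \<and> D < 0"
          using deriv'[of r] r s(1) t0 t by auto
      qed (use s(1) t0 t in \<open>auto intro!: cont\<close>)
      then show False using s(1) above by auto
    qed
    have "eventually (\<lambda>t. f t \<le> - \<epsilon>) (at_left T)"
      using eventually_at_left_real[OF t0(2)] by eventually_elim (auto intro: stays)
    then show ?thesis using lim by (intro tendsto_upperbound) auto
  next
    case False
    \<comment> \<open>The drift bound says that \<open>exp (d t) (f t + c)\<close> does not increase.\<close>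
    have bound: "f t \<le> (1 + c) * exp (- d * t) - c" if t: "0 \<le> t" "t < T" for t
    proof -
      have "exp (d * t) * (f t + c) \<le> exp (d * 0) * (f 0 + c)"
      proof (rule DERIV_nonpos_imp_decreasing_open[OF t(1)])
        fix r assume r: "0 < r" "r < t"
        have "((\<lambda>t. exp (d * t) * (f t + c)) has_real_derivative
                exp (d * r) * (d * (f r + c) + f' r)) (at r)"
          using deriv'[of r] r t
          by (auto intro!: derivative_eq_intros simp: algebra_simps)
        moreover have "d * (f r + c) + f' r \<le> 0"
        proof -
          have "\<not> f r \<le> - \<epsilon>" using False r t by auto
          then show ?thesis using drift[of r] r t by simp
        qed
        ultimately show "\<exists>D. ((\<lambda>t. exp (d * t) * (f t + c)) has_real_derivative D) (at r) \<and> D \<le> 0"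
          by (meson exp_ge_zero mult_nonneg_nonpos)
      qed (use t in \<open>auto intro!: continuous_intros cont\<close>)
      also have "\<dots> \<le> 1 + c" using \<open>f 0 \<le> 1\<close> by simp
      finally show ?thesis by (simp add: exp_minus field_simps)
    qed
    have "((\<lambda>t. (1 + c) * exp (- d * t) - c) \<longlongrightarrow> (1 + c) * exp (- d * T) - c) (at_left T)"
      by (intro tendsto_intros)
    moreover have "eventually (\<lambda>t. f t \<le> (1 + c) * exp (- d * t) - c) (at_left T)"
      using eventually_at_left_real[OF \<open>0 < T\<close>] by eventually_elim (intro bound; simp)
    ultimately have "y \<le> (1 + c) * exp (- d * T) - c"
      using lim by (intro tendsto_le) auto
    then show ?thesis using late by simp
  qed
qed

text \<open>
  The duration bound says that the comparison solution with \<open>c = tanh m / d\<close> is strictly negative at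
  time \<open>T\<close>.  Strictness leaves room to lower the target from \<open>0\<close> to \<open>-\<epsilon>\<close>, even though the force
  weakens to \<open>tanh (m - L \<epsilon>)\<close> there.
\<close>

lemma barrier_level_exists:
  fixes d L m T :: real
  assumes "0 < d" "0 < m" and T: "1 / d * ln ((d + tanh m) / tanh m) < T"
  shows "\<forall>\<^sub>F \<epsilon> in at_right 0. \<epsilon> < tanh (m - L * \<epsilon>) / d \<and>
    (1 + tanh (m - L * \<epsilon>) / d) * exp (- d * T) - tanh (m - L * \<epsilon>) / d \<le> - \<epsilon>"
proof -
  define c where "c \<epsilon> = tanh (m - L * \<epsilon>) / d" for \<epsilon>
  have tm: "0 < tanh m" using \<open>0 < m\<close> by simp
  have c: "(c \<longlongrightarrow> c 0) (at_right 0)"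
    unfolding c_def by (intro tendsto_intros) (use assms in auto)
  have c0: "0 < c 0" using tm \<open>0 < d\<close> by (simp add: c_def)
  have "ln ((d + tanh m) / tanh m) < d * T"
    using T \<open>0 < d\<close> by (simp add: field_simps)
  then have "(d + tanh m) / tanh m < exp (d * T)"
    using tm \<open>0 < d\<close> by (metis add_pos_pos divide_pos_pos exp_less_mono exp_ln)
  then have "(d + tanh m) / d < tanh m * exp (d * T) / d"
    using tm \<open>0 < d\<close> by (intro divide_strict_right_mono) (simp_all add: field_simps)
  then have "1 + c 0 < c 0 * exp (d * T)"
    using \<open>0 < d\<close> by (simp add: c_def add_divide_distrib)
  then have "(1 + c 0) / exp (d * T) < c 0"
    by (subst pos_divide_less_eq) auto
  then have "(1 + c 0) * exp (- d * T) < c 0"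
    by (simp add: exp_minus divide_inverse)
  moreover have "((\<lambda>\<epsilon>. (1 + c \<epsilon>) * exp (- d * T) - c \<epsilon> + \<epsilon>) \<longlongrightarrow> (1 + c 0) * exp (- d * T) - c 0 + 0) (at_right 0)"
    by (intro tendsto_intros c)
  ultimately have "\<forall>\<^sub>F \<epsilon> in at_right 0. (1 + c \<epsilon>) * exp (- d * T) - c \<epsilon> + \<epsilon> < 0"
    by (intro order_tendstoD(2)) auto
  moreover have "((\<lambda>\<epsilon>. \<epsilon> - c \<epsilon>) \<longlongrightarrow> 0 - c 0) (at_right 0)"
    by (intro tendsto_intros c)
  then have "\<forall>\<^sub>F \<epsilon> in at_right 0. \<epsilon> - c \<epsilon> < 0"
    by (rule order_tendstoD(2)) (use c0 in auto)
  ultimately show ?thesis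
    unfolding c_def by eventually_elim auto
qed

text \<open>
  The sign \<open>s\<close> makes the two directions of imbalance one case, because the drift is odd in \<open>(b, z)\<close>
  jointly.  Where \<open>s z\<^sub>i\<close> is nonnegative, self-reinforcement is at most
  \<open>max 0 (\<omega>\<^sub>i (u\<^sub>0\<^sub>i + K))\<close>, which the two gain conditions dominate with a margin \<open>m\<close>.  Where \<open>s z\<^sub>i\<close> is
  negative, self-reinforcement can oppose the queue term only through a negative \<open>u\<^sub>0\<^sub>i\<close>, and then by
  at most \<open>\<omega>\<^sub>i \<bar>u\<^sub>0\<^sub>i\<bar> \<epsilon>\<close>.
\<close>

lemma drift_against_imbalance:
  fixes P :: "('n::finite) params" and z :: "real^'n"
  assumes params: "valid_params P" and s: "s \<in> {1, -1}" and b: "2 \<le> s * b"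
    and z: "\<And>j. z $ j \<in> {-1..1}"
    and gain: "queue_gain P i * 2 \<ge> self_gain P i * (base_attention P i + attention_gain P)
         + social_gain P i * matrix_norm_inf (adjacency P) + m"
    and gain0: "queue_gain P i * 2 \<ge> social_gain P i * matrix_norm_inf (adjacency P) + m"
    and m: "0 < m" and \<epsilon>: "0 \<le> \<epsilon>" "- \<epsilon> \<le> s * z $ i"
  shows "s * opinion_drift P b z $ i \<le>
    - damping P i * (s * z $ i) - tanh (m - self_gain P i * \<bar>base_attention P i\<bar> * \<epsilon>)"
proof -
  let ?w = "self_gain P i" and ?u = "base_attention P i" and ?K = "attention_gain P"
  let ?S = "\<Sum>j\<in>UNIV - {i}. adjacency P i j * z $ j"
  let ?norm = "matrix_norm_inf (adjacency P)"
  define f where "f = s * z $ i"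
  have pos: "0 \<le> ?w" "0 \<le> social_gain P i" "0 \<le> ?K"
    using params by (auto simp: valid_params_def)
  have f1: "f \<le> 1" using z[of i] s by (auto simp: f_def)
  have f2: "f\<^sup>2 = (z $ i)\<^sup>2" using s by (auto simp: f_def)
  have "\<bar>?S\<bar> \<le> (\<Sum>j\<in>UNIV - {i}. \<bar>adjacency P i j * z $ j\<bar>)" by (rule sum_abs)
  also have "\<dots> \<le> (\<Sum>j\<in>UNIV - {i}. \<bar>adjacency P i j\<bar>)"
    using z by (intro sum_mono) (auto simp: abs_mult abs_le_iff intro!: mult_left_le)
  also have "\<dots> \<le> (\<Sum>j\<in>UNIV. \<bar>adjacency P i j\<bar>)" by (rule sum_mono2) auto
  also have "\<dots> \<le> ?norm" unfolding matrix_norm_inf_def by (rule Max_ge) auto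
  finally have abs_S: "\<bar>?S\<bar> \<le> ?norm" .
  then have norm: "0 \<le> ?norm" by (rule order_trans[OF abs_ge_zero])
  have S: "s * ?S \<le> ?norm" using abs_S s by auto
  have soc: "social_gain P i * (s * ?S) \<le> social_gain P i * ?norm"
    using S pos by (intro mult_left_mono)
  have "0 \<le> queue_gain P i"
    using gain0 m mult_nonneg_nonneg[OF pos(2) norm] by linarith
  then have que: "queue_gain P i * 2 \<le> queue_gain P i * (s * b)"
    using b by (intro mult_left_mono)
  have self: "?w * (?u + ?K * f\<^sup>2) * f + social_gain P i * ?norm - queue_gain P i * 2
      \<le> - (m - ?w * \<bar>?u\<bar> * \<epsilon>)"
  proof (cases "0 \<le> f")
    case True
    have "f\<^sup>2 \<le> 1" using True f1 by (simp add: power_le_one)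
    then have "?w * (?u + ?K * f\<^sup>2) * f \<le> ?w * (?u + ?K) * f"
      using pos True by (intro mult_right_mono mult_left_mono add_left_mono mult_left_le) auto
    also have "\<dots> \<le> max 0 (?w * (?u + ?K))"
      using True f1 by (cases "0 \<le> ?w * (?u + ?K)")
        (auto simp: mult_left_le mult_nonpos_nonneg max_def)
    finally have "?w * (?u + ?K * f\<^sup>2) * f + social_gain P i * ?norm - queue_gain P i * 2 \<le> - m"
      using gain gain0 by (auto simp: max_def split: if_splits)
    moreover have "0 \<le> ?w * \<bar>?u\<bar> * \<epsilon>" using pos \<epsilon> by simp
    ultimately show ?thesis by linarith
  next
    case False
    have "?K * f\<^sup>2 * f \<le> 0" using False pos by (simp add: mult_nonneg_nonpos)
    moreover have "?u * f \<le> \<bar>?u\<bar> * \<epsilon>"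
    proof -
      have "?u * f \<le> \<bar>?u\<bar> * \<bar>f\<bar>" by (metis abs_ge_self abs_mult)
      also have "\<dots> \<le> \<bar>?u\<bar> * \<epsilon>" using False \<epsilon> by (intro mult_left_mono) (auto simp: f_def)
      finally show ?thesis .
    qed
    ultimately have "?w * ((?u + ?K * f\<^sup>2) * f) \<le> ?w * (\<bar>?u\<bar> * \<epsilon>)"
      using pos by (intro mult_left_mono) (auto simp: algebra_simps)
    then show ?thesis using gain0 by (simp add: mult.assoc)
  qed
  have odd: "s * tanh a = tanh (s * a)" for a :: real using s by auto
  have "s * opinion_drift P b z $ i = - damping P i * f +
      tanh (s * (?w * (?u + ?K * (z $ i)\<^sup>2) * z $ i + social_gain P i * ?S - queue_gain P i * b))"
    unfolding odd[symmetric] by (simp add: opinion_drift_def f_def algebra_simps)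
  also have "s * (?w * (?u + ?K * (z $ i)\<^sup>2) * z $ i + social_gain P i * ?S - queue_gain P i * b)
      = ?w * (?u + ?K * f\<^sup>2) * f + social_gain P i * (s * ?S) - queue_gain P i * (s * b)"
    unfolding f2 by (simp add: f_def algebra_simps)
  also have "tanh \<dots> \<le> - tanh (m - ?w * \<bar>?u\<bar> * \<epsilon>)"
    using self soc que by (simp flip: tanh_minus)
  finally show ?thesis by (simp add: f_def)
qed

text \<open>
  Both the sign and the uniform margin \<open>\<eta>\<close> matter: the sign makes members of the shorter queue
  stay, while \<open>\<eta>\<close> bounds from below the probability that a member of the longer queue switches.
\<close>

lemma opinions_oppose_imbalance:
  fixes P :: "('n::finite) params"
  assumes params: "valid_params P" and m: "0 < m"
    and gain: "\<And>i. queue_gain P i * 2 \<ge> self_gain P i * (base_attention P i + attention_gain P)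
         + social_gain P i * matrix_norm_inf (adjacency P) + m"
    and gain0: "\<And>i. queue_gain P i * 2 \<ge> social_gain P i * matrix_norm_inf (adjacency P) + m"
    and duration: "\<And>i. 1 / damping P i * ln ((damping P i + tanh m) / tanh m) < interval P"
  obtains \<eta> where "0 < \<eta>" "\<eta> \<le> 1"
    "\<And>b z z' s i. opinion_step P b z z' \<Longrightarrow> s \<in> {1, -1} \<Longrightarrow> 2 \<le> s * b \<Longrightarrow> \<eta> \<le> - s * z' $ i"
proof -
  define c where "c i \<epsilon> = tanh (m - self_gain P i * \<bar>base_attention P i\<bar> * \<epsilon>) / damping P i" for i \<epsilon>
  have damp: "0 < damping P i" for i using params by (simp add: valid_params_def)
  have "\<forall>\<^sub>F \<epsilon> in at_right 0. \<forall>i. \<epsilon> < c i \<epsilon> \<and>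
      (1 + c i \<epsilon>) * exp (- damping P i * interval P) - c i \<epsilon> \<le> - \<epsilon>"
    unfolding c_def by (intro eventually_all_finite barrier_level_exists damp m duration)
  moreover have "\<forall>\<^sub>F \<epsilon> in at_right (0::real). \<epsilon> \<in> {0<..<1}"
    by (rule eventually_at_right_real) simp
  ultimately have "\<forall>\<^sub>F \<epsilon> in at_right 0. (\<forall>i. \<epsilon> < c i \<epsilon> \<and>
      (1 + c i \<epsilon>) * exp (- damping P i * interval P) - c i \<epsilon> \<le> - \<epsilon>) \<and> \<epsilon> \<in> {0<..<1}"
    by (rule eventually_conj)
  then obtain \<epsilon> where \<epsilon>: "0 < \<epsilon>" "\<epsilon> < 1" "\<And>i. \<epsilon> < c i \<epsilon>"
      "\<And>i. (1 + c i \<epsilon>) * exp (- damping P i * interval P) - c i \<epsilon> \<le> - \<epsilon>"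
    by (metis (no_types, lifting) eventually_happens' greaterThanLessThan_iff trivial_limit_at_right_real)
  have "\<epsilon> \<le> - s * z' $ i" if step: "opinion_step P b z z'" and s: "s \<in> {1, -1}" and b: "2 \<le> s * b"
    for b s and z z' :: "real^'n" and i
  proof -
    obtain x where x: "x 0 = z"
      "\<And>t. t\<in>{0..<interval P} \<Longrightarrow>
        (x has_vector_derivative opinion_drift P b (x t)) (at t within {0..<interval P})"
      "(x \<longlongrightarrow> z') (at_left (interval P))"
      "\<And>t i. t\<in>{0..<interval P} \<Longrightarrow> x t $ i \<in> {-1..1}"
      using step unfolding opinion_step_def by blast
    have T: "0 < interval P" using params by (simp add: valid_params_def)
    have "s * z' $ i \<le> - \<epsilon>"
    proof (rule barrier_reached[where f = "\<lambda>t. s * x t $ i" and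
          f' = "\<lambda>t. s * opinion_drift P b (x t) $ i" and d = "damping P i" and c = "c i \<epsilon>"])
      fix t assume t: "t \<in> {0..<interval P}"
      have "((\<lambda>t. x t $ i) has_vector_derivative opinion_drift P b (x t) $ i) (at t within {0..<interval P})"
        using x(2)[OF t] bounded_linear.has_vector_derivative[OF bounded_linear_vec_nth] by blast
      then show "((\<lambda>t. s * x t $ i) has_real_derivative s * opinion_drift P b (x t) $ i)
          (at t within {0..<interval P})"
        by (intro DERIV_cmult) (simp add: has_real_derivative_iff_has_vector_derivative)
      assume "- \<epsilon> \<le> s * x t $ i"
      then have "s * opinion_drift P b (x t) $ i \<le> - damping P i * (s * x t $ i)
          - tanh (m - self_gain P i * \<bar>base_attention P i\<bar> * \<epsilon>)"
        using \<epsilon>(1) x(4)[OF t] by (intro drift_against_imbalance params s b gain gain0 m) auto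
      then show "s * opinion_drift P b (x t) $ i \<le> - damping P i * (s * x t $ i + c i \<epsilon>)"
        using damp[of i] by (simp add: c_def distrib_left)
    next
      show "s * x 0 $ i \<le> 1" using x(4)[of 0 i] T s by auto
      show "((\<lambda>t. s * x t $ i) \<longlongrightarrow> s * z' $ i) (at_left (interval P))"
        by (intro tendsto_intros x(3))
    qed (use T damp \<epsilon> in auto)
    then show ?thesis by simp
  qed
  then show thesis using \<epsilon> by (intro that[of \<epsilon>]) auto
qed

section \<open>Locations along one trajectory\<close>

lemma imbalance_eq_sum:
  assumes "\<And>i. l i \<in> {0, 1, -1}"
  shows "imbalance l = (\<Sum>i\<in>UNIV. l i)"
proof -
  have "(\<Sum>i\<in>UNIV. l i) = (\<Sum>i\<in>UNIV. (if i \<in> queue_A l then 1 else 0) - (if i \<in> queue_B l then 1 else 0))"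
    by (intro sum.cong refl) (use assms in \<open>force simp: queue_A_def queue_B_def\<close>)
  then show ?thesis by (simp add: imbalance_def sum_subtractf sum.If_cases)
qed

text \<open>
  Outside the band the imbalance is at least \<open>2\<close>: when \<open>N\<close> is even and everyone queues, it is a sum of
  \<open>N\<close> odd numbers, so it cannot be \<open>\<plusminus>1\<close>.
\<close>

lemma abs_imbalance_ge_2:
  fixes l :: "'n::finite \<Rightarrow> int"
  assumes loc: "\<And>i. l i \<in> {0, 1, -1}" and "pool l = {}"
    and "nash_tolerance CARD('n) < \<bar>imbalance l\<bar>"
  shows "2 \<le> \<bar>imbalance l\<bar>"
proof (cases "even CARD('n)")
  case True
  have "odd (l i)" for i
    using loc[of i] assms(2) by (auto simp: pool_def)
  then have "even (imbalance l)"
    using True by (simp add: imbalance_eq_sum[OF loc] even_sum_iff)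
  then show ?thesis using assms(3) True by (auto simp: nash_tolerance_def elim!: evenE)
qed (use assms(3) in \<open>auto simp: nash_tolerance_def\<close>)

lemma next_location_nonzero: "l \<noteq> 0 \<Longrightarrow> next_location u x l \<noteq> 0"
  by (auto simp: next_location_def)

lemma next_location_joins: "u \<le> \<bar>x\<bar> \<Longrightarrow> x \<noteq> 0 \<Longrightarrow> next_location u x l \<noteq> 0"
  by (auto simp: next_location_def sgn_if floor_eq_iff)

text \<open>
  Which waiting agent has the strong opinion may vary with the epoch.  If every draw is at most
  \<open>\<zeta>\<close>, that agent joins a queue, whoever it is; so the pool loses a member per epoch.
\<close>

lemma pool_emptied:
  fixes l :: "nat \<Rightarrow> 'n::finite \<Rightarrow> int"
  assumes update: "\<And>t i. l (Suc t) i = next_location (u t i) (x t i) (l t i)"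
    and "0 < \<zeta>" and active: "\<And>t. pool (l t) \<noteq> {} \<Longrightarrow> \<exists>i\<in>pool (l t). \<zeta> \<le> \<bar>x t i\<bar>"
    and draws: "\<And>j i. j < CARD('n) \<Longrightarrow> u (k + j) i \<le> \<zeta>"
  shows "pool (l (k + CARD('n))) = {}"
proof -
  have "card (pool (l (k + j))) \<le> CARD('n) - j" if "j \<le> CARD('n)" for j
    using that
  proof (induction j)
    case 0
    show ?case by (simp add: card_mono)
  next
    case (Suc j)
    have sub: "pool (l (k + Suc j)) \<subseteq> pool (l (k + j))"
      using next_location_nonzero by (fastforce simp: pool_def update)
    show ?case
    proof (cases "pool (l (k + j)) = {}")
      case True
      then show ?thesis using sub by simp
    next
      case False
      then obtain i where i: "i \<in> pool (l (k + j))" "\<zeta> \<le> \<bar>x (k + j) i\<bar>"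
        using active by blast
      have "u (k + j) i \<le> \<bar>x (k + j) i\<bar>" using draws[of j i] Suc.prems i(2) by simp
      then have "i \<notin> pool (l (k + Suc j))"
        using next_location_joins i(2) \<open>0 < \<zeta>\<close> by (auto simp: pool_def update)
      then have "card (pool (l (k + Suc j))) < card (pool (l (k + j)))"
        using sub i(1) by (intro psubset_card_mono) auto
      then show ?thesis using Suc by simp
    qed
  qed
  from this[of "CARD('n)"] show ?thesis by simp
qed

text \<open>
  The draws single out one agent \<open>e j\<close> per epoch.  If it is in the longer queue it switches, and nobody
  else moves; so the imbalance falls by \<open>2\<close> or stays, without jumping over the band.  If the band were
  missed throughout, then after a full round every agent would be in the queue that was
  shorter at the start, although by the same reasoning that queue is still the shorter one.
\<close>

lemma queues_balanced:
  fixes l :: "nat \<Rightarrow> 'n::finite \<Rightarrow> int" and e :: "nat \<Rightarrow> 'n"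
  assumes update: "\<And>t i. l (Suc t) i = next_location (u t i) (x t i) (l t i)"
    and loc: "\<And>t i. l t i \<in> {0, 1, -1}"
    and e: "bij_betw e {..<CARD('n)} UNIV"
    and "0 < \<eta>" "0 < \<psi>"
    and oppose: "\<And>t i s. s \<in> {1, -1} \<Longrightarrow> 2 \<le> s * imbalance (l t) \<Longrightarrow> \<eta> \<le> - real_of_int s * x t i"
    and hold: "\<And>t i. pool (l t) = {} \<Longrightarrow> nash_tolerance CARD('n) < \<bar>imbalance (l t)\<bar> \<Longrightarrow>
      i \<in> expensive_queue (l t) \<Longrightarrow> \<bar>x t i\<bar> \<le> \<psi>"
    and start: "pool (l k) = {}"
    and mover: "\<And>j. j < CARD('n) \<Longrightarrow> u (k + j) (e j) \<in> {0<..\<eta>}"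
    and others: "\<And>j i. j < CARD('n) \<Longrightarrow> i \<noteq> e j \<Longrightarrow> \<psi> < u (k + j) i"
  shows "\<exists>j\<le>CARD('n). pool (l (k + j)) = {} \<and> \<bar>imbalance (l (k + j))\<bar> \<le> nash_tolerance CARD('n)"
proof (rule ccontr)
  assume no: "\<not> ?thesis"
  define s where "s = sgn (imbalance (l k))"
  have "2 \<le> \<bar>imbalance (l k)\<bar>"
    using no start by (intro abs_imbalance_ge_2[OF loc]) force+
  then have s: "s \<in> {1, -1}" and s0: "2 \<le> s * imbalance (l k)"
    by (auto simp: s_def sgn_if split: if_splits)
  have "pool (l (k + j)) = {} \<and> 2 \<le> s * imbalance (l (k + j)) \<and> (\<forall>i<j. l (k + j) (e i) = - s)"
    if "j \<le> CARD('n)" for j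
    using that
  proof (induction j)
    case 0
    show ?case using start s0 by simp
  next
    case (Suc j)
    let ?l = "l (k + j)" and ?l' = "l (k + Suc j)"
    from Suc have j: "j < CARD('n)" and empty: "pool ?l = {}" and imb: "2 \<le> s * imbalance ?l"
      and moved: "\<And>i. i < j \<Longrightarrow> ?l (e i) = - s" by auto
    have far: "nash_tolerance CARD('n) < \<bar>imbalance ?l\<bar>"
      using no j empty by force
    have x: "\<eta> \<le> - real_of_int s * x (k + j) i" for i
      using oppose[OF s imb] .
    have sgn_x: "sgn (x (k + j) i) = - real_of_int s" for i
      using x[of i] s \<open>0 < \<eta>\<close> by (auto simp: sgn_if)
    have pm: "?l i = s \<or> ?l i = - s" for i
      using loc[of "k + j" i] empty s by (auto simp: pool_def)
    \<comment> \<open>A draw of exactly \<open>0\<close> would make even a member of the shorter queue switch.\<close>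
    have u0: "0 < u (k + j) i" for i
      using mover[OF j] others[OF j, of i] \<open>0 < \<psi>\<close> by (cases "i = e j") auto
    have stay: "?l' i = - s" if "?l i = - s" for i
      using that s u0[of i] sgn_x[of i] by (auto simp: update next_location_def)
    have move: "?l' (e j) = - s" if "?l (e j) = s"
    proof -
      have "u (k + j) (e j) \<le> \<bar>x (k + j) (e j)\<bar>"
        using mover[OF j] x[of "e j"] s by auto
      then show ?thesis using that s sgn_x[of "e j"] by (auto simp: update next_location_def)
    qed
    have wait: "?l' i = s" if "?l i = s" "i \<noteq> e j" for i
    proof -
      have "i \<in> expensive_queue ?l"
        using that s imb by (auto simp: expensive_queue_def imbalance_def queue_A_def queue_B_def)
      then have "\<bar>x (k + j) i\<bar> < u (k + j) i"
        using hold[OF empty far] others[OF j that(2)] by force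
      then show ?thesis using that s by (auto simp: update next_location_def)
    qed
    have new: "?l' = ?l(e j := - s)"
    proof
      fix i
      show "?l' i = (?l(e j := - s)) i"
        using stay[of i] move wait[of i] pm[of i] by (cases "i = e j") auto
    qed
    have sum: "(\<Sum>i\<in>UNIV. ?l' i) = (\<Sum>i\<in>UNIV. ?l i) - ?l (e j) - s"
      unfolding new by (simp add: sum.remove[of UNIV "e j"])
    have empty': "pool ?l' = {}"
      using empty s unfolding new by (auto simp: pool_def split: if_splits)
    have "2 \<le> \<bar>imbalance ?l'\<bar>"
      using no empty' Suc.prems by (intro abs_imbalance_ge_2[OF loc]) force+
    \<comment> \<open>At most one agent moved, so the imbalance cannot jump from one side over the band.\<close>
    moreover have "0 \<le> s * imbalance ?l'"
      using sum imb pm[of "e j"] s unfolding imbalance_eq_sum[OF loc] by auto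
    ultimately have "2 \<le> s * imbalance ?l'" using s by auto
    then show ?case
      using empty' moved stay move pm[of "e j"] by (auto simp: less_Suc_eq)
  qed
  from this[of "CARD('n)"]
  have imb: "2 \<le> s * imbalance (l (k + CARD('n)))"
    and all: "\<And>j. j < CARD('n) \<Longrightarrow> l (k + CARD('n)) (e j) = - s" by auto
  have "l (k + CARD('n)) i = - s" for i
    using all e unfolding bij_betw_def by (metis UNIV_I imageE lessThan_iff)
  then have "s * imbalance (l (k + CARD('n))) = - (s * s) * int CARD('n)"
    by (simp add: imbalance_eq_sum[OF loc])
  also have "\<dots> \<le> 0" by simp
  finally show False using imb by simp
qed

section \<open>Independent blocks of draws\<close>

text \<open>
  The time \<open>T\<close> is at most \<open>L\<close> times the number of blocks up to and including the first success.  That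
  number is the sum over \<open>r\<close> of the indicators of \<open>B r\<close>, no success among the first \<open>r\<close> blocks, whose
  probabilities are bounded by a geometric series.
\<close>

lemma (in prob_space) nn_integral_finite_if_geometric_tail:
  fixes T :: "'a \<Rightarrow> ennreal" and Y :: "nat \<Rightarrow> 'a \<Rightarrow> bool"
  assumes indep: "indep_vars (\<lambda>_. count_space UNIV) Y UNIV"
    and "0 < L" "0 < p" and success: "\<And>r. p \<le> prob {\<omega> \<in> space M. Y r \<omega>}"
    and bound: "AE \<omega> in M. \<forall>r. Y r \<omega> \<longrightarrow> T \<omega> \<le> of_nat (L * Suc r)"
  shows "(\<integral>\<^sup>+ \<omega>. T \<omega> \<partial>M) < \<infinity>"
proof -
  have Y [measurable]: "Y r \<in> M \<rightarrow>\<^sub>M count_space UNIV" for r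
    using indep by (auto simp: indep_vars_def)
  define B where "B r = {\<omega> \<in> space M. \<forall>s<r. \<not> Y s \<omega>}" for r
  have B [measurable]: "B r \<in> sets M" for r unfolding B_def by measurable
  have p1: "p \<le> 1" using order_trans[OF success prob_le_1] .
  have fail: "prob (Y s -` {False} \<inter> space M) \<le> 1 - p" for s
  proof -
    have "prob (space M - {\<omega> \<in> space M. Y s \<omega>}) = 1 - prob {\<omega> \<in> space M. Y s \<omega>}"
      by (intro prob_compl) measurable
    also have "space M - {\<omega> \<in> space M. Y s \<omega>} = Y s -` {False} \<inter> space M" by auto
    finally show ?thesis using success[of s] by simp
  qed
  have tail: "prob (B r) \<le> (1 - p) ^ r" for r
  proof (cases "r = 0")
    case False
    have "B r = (\<Inter>s\<in>{..<r}. Y s -` {False} \<inter> space M)"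
      using False by (auto simp: B_def)
    also have "prob \<dots> = (\<Prod>s<r. prob (Y s -` {False} \<inter> space M))"
      by (rule indep_varsD[OF indep]) (use False in auto)
    also have "\<dots> \<le> (\<Prod>s<r. 1 - p)"
      by (intro prod_mono conjI measure_nonneg fail)
    finally show ?thesis by simp
  qed (auto simp: B_def prob_space)
  have "AE \<omega> in M. T \<omega> \<le> (\<Sum>r. of_nat L * indicator (B r) \<omega>)"
    using bound
  proof (rule AE_mp, intro AE_I2 impI)
    fix \<omega> assume \<omega>: "\<omega> \<in> space M" and T: "\<forall>r. Y r \<omega> \<longrightarrow> T \<omega> \<le> of_nat (L * Suc r)"
    let ?sum = "\<Sum>r. of_nat L * indicator (B r) \<omega> :: ennreal"
    have fails: "of_nat (L * Suc n) \<le> ?sum" if "\<And>s. s < n \<Longrightarrow> \<not> Y s \<omega>" for n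
    proof -
      have "(of_nat (L * Suc n) :: ennreal) = (\<Sum>r<Suc n. of_nat L)"
        by (simp only: sum_constant card_lessThan of_nat_mult mult.commute)
      also have "\<dots> = (\<Sum>r<Suc n. of_nat L * indicator (B r) \<omega>)"
        using that \<omega> by (intro sum.cong) (auto simp: B_def)
      also have "\<dots> \<le> ?sum" by (intro sum_le_suminf) auto
      finally show ?thesis .
    qed
    show "T \<omega> \<le> ?sum"
    proof (cases "\<exists>r. Y r \<omega>")
      case True
      define n where "n = (LEAST r. Y r \<omega>)"
      have "Y n \<omega>" unfolding n_def using True by (rule LeastI_ex)
      then have "T \<omega> \<le> of_nat (L * Suc n)" using T by blast
      also have "\<dots> \<le> ?sum" by (rule fails) (auto simp: n_def dest: not_less_Least)
      finally show ?thesis .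
    next
      case False
      have large: "(of_nat n :: ennreal) \<le> ?sum" for n
      proof -
        have "n \<le> L * Suc n" using \<open>0 < L\<close> by (cases L) auto
        then have "(of_nat n :: ennreal) \<le> of_nat (L * Suc n)" by (rule of_nat_mono)
        also have "\<dots> \<le> ?sum" by (rule fails) (use False in blast)
        finally show ?thesis .
      qed
      have "?sum = \<top>"
      proof (rule ccontr)
        assume "?sum \<noteq> \<top>"
        then obtain n where "?sum < of_nat n"
          unfolding less_top using ennreal_Ex_less_of_nat by blast
        then show False using large[of n] by (meson leD)
      qed
      then show ?thesis by simp
    qed
  qed
  then have "(\<integral>\<^sup>+ \<omega>. T \<omega> \<partial>M) \<le> (\<integral>\<^sup>+ \<omega>. (\<Sum>r. of_nat L * indicator (B r) \<omega>) \<partial>M)"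
    by (rule nn_integral_mono_AE)
  also have "\<dots> = (\<Sum>r. of_nat L * emeasure M (B r))"
    by (simp add: nn_integral_suminf nn_integral_cmult)
  also have "\<dots> \<le> (\<Sum>r. ennreal (real L * (1 - p) ^ r))"
  proof (intro suminf_le)
    fix r
    show "of_nat L * emeasure M (B r) \<le> ennreal (real L * (1 - p) ^ r)"
      using tail[of r] by (simp add: emeasure_eq_measure ennreal_mult' ennreal_of_nat_eq_real_of_nat
          ennreal_leI mult_left_mono p1)
  qed auto
  also have "\<dots> < \<infinity>"
  proof -
    have "summable (\<lambda>r. real L * (1 - p) ^ r)"
      using \<open>0 < p\<close> p1 by (intro summable_mult summable_geometric) auto
    then show ?thesis
      using p1 by (simp add: ennreal_suminf_neq_top less_top[symmetric])
  qed
  finally show ?thesis .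
qed

context queue_chain
begin

lemma draw_in_interval:
  assumes "0 \<le> a" "a < b" "b \<le> 1"
  shows "b - a \<le> prob (U k i -` {a<..b} \<inter> space M)"
proof -
  have U: "U k i \<in> borel_measurable M"
    using indep_draws unfolding indep_vars_def by auto
  have "ennreal (b - a) = emeasure lborel {a<..<b}"
    using assms by simp
  also have "\<dots> \<le> emeasure lborel ({0<..<1} \<inter> {a<..b})"
    by (intro emeasure_mono) (use assms in auto)
  also have "\<dots> = emeasure (uniform_measure lborel {0<..<1}) {a<..b}"
    by (simp add: emeasure_uniform_measure divide_ennreal_def)
  also have "\<dots> = emeasure M (U k i -` {a<..b} \<inter> space M)"
    unfolding uniform_draws[of k i, symmetric] by (rule emeasure_distr[OF U]) simp
  finally show ?thesis by (simp add: emeasure_eq_measure)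
qed

text \<open>
  Disjoint blocks of \<open>L\<close> epochs use disjoint families of independent draws; a prescribed interval for
  each of the \<open>L N\<close> draws in a block is met with probability at least \<open>\<delta>\<close> each.
\<close>

lemma draw_blocks:
  fixes a b :: "nat \<Rightarrow> 'n \<Rightarrow> real" and L :: nat
  defines "Y \<equiv> \<lambda>r \<omega>. \<forall>k<L. \<forall>i. U (L * r + k) i \<omega> \<in> {a k i<..b k i}"
  assumes "0 < \<delta>" "0 < L" and ab: "\<And>k i. 0 \<le> a k i" "\<And>k i. \<delta> \<le> b k i - a k i" "\<And>k i. b k i \<le> 1"
  shows "indep_vars (\<lambda>_. count_space UNIV) Y UNIV"
    and "\<delta> ^ (L * CARD('n)) \<le> prob {\<omega> \<in> space M. Y r \<omega>}"
proof -
  define K :: "nat \<Rightarrow> (nat \<times> 'n) set" where "K r = (\<lambda>(k, i). (L * r + k, i)) ` ({..<L} \<times> UNIV)" for r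
  have K: "(L * r + k, i) \<in> K r" if "k < L" for r k i
    using that by (auto simp: K_def)
  have "disjoint_family K"
    unfolding disjoint_family_on_def
  proof (intro ballI impI)
    fix r r' :: nat assume "r \<noteq> r'"
    have "fst p div L = r" if "p \<in> K r" for p r
      using that by (auto simp: K_def)
    then show "K r \<inter> K r' = {}" using \<open>r \<noteq> r'\<close> by blast
  qed
  then have "indep_vars (\<lambda>r. PiM (K r) (\<lambda>_. borel)) (\<lambda>r \<omega>. restrict (\<lambda>p. (case p of (k, i) \<Rightarrow> U k i) \<omega>) (K r)) UNIV"
    by (intro indep_vars_restrict[OF indep_draws]) auto
  then have "indep_vars (\<lambda>_. count_space UNIV)
      (\<lambda>r \<omega>. (\<lambda>g. \<forall>k\<in>{..<L}. \<forall>i\<in>UNIV. g (L * r + k, i) \<in> {a k i<..b k i})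
        (restrict (\<lambda>p. (case p of (k, i) \<Rightarrow> U k i) \<omega>) (K r))) UNIV"
  proof (rule indep_vars_compose2)
    fix r
    have [measurable]: "(\<lambda>g. g (L * r + k, i)) \<in> borel_measurable (PiM (K r) (\<lambda>_. borel :: real measure))"
      if "k < L" for k i
      using K[OF that] by (rule measurable_component_singleton)
    show "(\<lambda>g. \<forall>k\<in>{..<L}. \<forall>i\<in>UNIV. g (L * r + k, i) \<in> {a k i<..b k i})
        \<in> PiM (K r) (\<lambda>_. borel) \<rightarrow>\<^sub>M count_space UNIV"
      by measurable
  qed
  then show "indep_vars (\<lambda>_. count_space UNIV) Y UNIV"
    unfolding Y_def by (rule back_subst[where P = "\<lambda>Z. indep_vars _ Z UNIV"])
      (auto simp: K fun_eq_iff)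
  define S where "S r = (\<lambda>(n, i). {a (n - L * r) i<..b (n - L * r) i})" for r
  have fin: "finite (K r)" by (simp add: K_def)
  have "inj_on (\<lambda>(k, i :: 'n). (L * r + k, i)) ({..<L} \<times> UNIV)"
    by (auto simp: inj_on_def)
  then have card: "card (K r) = L * CARD('n)"
    unfolding K_def by (subst card_image) (simp_all add: card_cartesian_product)
  have "{\<omega> \<in> space M. Y r \<omega>} = (\<Inter>p\<in>K r. (case p of (k, i) \<Rightarrow> U k i) -` S r p \<inter> space M)"
    using \<open>0 < L\<close> by (auto simp: Y_def K_def S_def)
  also have "prob \<dots> = (\<Prod>p\<in>K r. prob ((case p of (k, i) \<Rightarrow> U k i) -` S r p \<inter> space M))"
    by (rule indep_varsD[OF indep_draws]) (use fin \<open>0 < L\<close> in \<open>auto simp: K_def S_def\<close>)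
  also have "\<dots> \<ge> (\<Prod>p\<in>K r. \<delta>)"
  proof (intro prod_mono conjI)
    fix p assume "p \<in> K r"
    then obtain k i where p: "p = (L * r + k, i)" by (auto simp: K_def)
    have "\<delta> \<le> b k i - a k i" by (rule ab)
    also have "\<dots> \<le> prob (U (L * r + k) i -` {a k i<..b k i} \<inter> space M)"
      using ab(1,3)[of k i] ab(2)[of k i] \<open>0 < \<delta>\<close> by (intro draw_in_interval) auto
    finally show "\<delta> \<le> prob ((case p of (k, i) \<Rightarrow> U k i) -` S r p \<inter> space M)"
      by (simp add: p S_def)
  qed (use \<open>0 < \<delta>\<close> in simp)
  finally show "\<delta> ^ (L * CARD('n)) \<le> prob {\<omega> \<in> space M. Y r \<omega>}"
    by (simp add: card)
qed

end

section \<open>Expected time to balance\<close>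

theorem theorem1:
  fixes M :: "'w measure"
    and P :: "('n::finite) params"
    and U :: "nat \<Rightarrow> 'n \<Rightarrow> 'w \<Rightarrow> real"
    and X :: "nat \<Rightarrow> 'w \<Rightarrow> (real^'n) \<times> ('n \<Rightarrow> int)"
    and \<zeta> m \<psi> :: real
  assumes params: "valid_params P"
    and chain: "queue_chain M P U X"
    and start: "AE \<omega> in M. X 0 \<omega> \<notin> nash_band"
    and pool_active: "\<zeta> > 0"
      "AE \<omega> in M. \<forall>k. card (pool (snd (X k \<omega>))) > 0 \<longrightarrow>
         (\<exists>i\<in>pool (snd (X k \<omega>)). \<bar>fst (X (Suc k) \<omega>) $ i\<bar> \<ge> \<zeta>)"
    and gain: "m > 0"
      "\<forall>i. queue_gain P i * b_sharp \<ge>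
         self_gain P i * (base_attention P i + attention_gain P)
         + social_gain P i * matrix_norm_inf (adjacency P) + m"
    \<comment> \<open>Implied by the previous inequality unless
      \<open>self_gain P i * (base_attention P i + attention_gain P) < 0\<close>,
      a case in which the conclusion can fail without it.\<close>
    and gain_without_self: "\<forall>i. queue_gain P i * b_sharp \<ge>
         social_gain P i * matrix_norm_inf (adjacency P) + m"
    and duration: "interval P >
      (MAX i. 1 / damping P i * ln ((damping P i + tanh m) / tanh m))"
    and not_unanimous: "0 < \<psi>" "\<psi> < 1"
      "AE \<omega> in M. \<forall>k. X k \<omega> \<notin> nash_band \<and> card (pool (snd (X k \<omega>))) = 0 \<longrightarrow>
         (\<forall>i\<in>expensive_queue (snd (X k \<omega>)). \<bar>fst (X (Suc k) \<omega>) $ i\<bar> \<le> \<psi>)"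
  shows "(\<integral>\<^sup>+ \<omega>. hitting_time X nash_band \<omega> \<partial>M) < \<infinity>"
proof -
  interpret queue_chain M P U X by (rule chain)
  have "1 / damping P i * ln ((damping P i + tanh m) / tanh m) < interval P" for i
    by (rule le_less_trans[OF Max_ge duration]) auto
  then obtain \<eta> where \<eta>: "0 < \<eta>" "\<eta> \<le> 1"
    and oppose: "\<And>b z z' s i. opinion_step P b z z' \<Longrightarrow> s \<in> {1, -1} \<Longrightarrow> 2 \<le> s * b \<Longrightarrow> \<eta> \<le> - s * z' $ i"
    using opinions_oppose_imbalance[OF params gain(1) gain(2)[unfolded b_sharp_def, rule_format]
        gain_without_self[unfolded b_sharp_def, rule_format]] by blast
  obtain e :: "nat \<Rightarrow> 'n" where e: "bij_betw e {..<CARD('n)} UNIV"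
    using ex_bij_betw_nat_finite[OF finite[of UNIV]] by (auto simp: atLeast0LessThan)
  let ?N = "CARD('n)"
  define L where "L = 2 * ?N"
  \<comment> \<open>Epochs \<open>k < N\<close> of a block empty the pool; epoch \<open>k \<ge> N\<close> is the turn of agent \<open>e (k - N)\<close>.\<close>
  define a where "a k i = (if k < ?N \<or> i = e (k - ?N) then 0 else \<psi>)" for k i
  define b where "b k i = (if k < ?N then min \<zeta> 1 else if i = e (k - ?N) then \<eta> else 1)" for k i
  define \<delta> where "\<delta> = min (min \<zeta> 1) (min \<eta> (1 - \<psi>))"
  define Y where "Y = (\<lambda>r \<omega>. \<forall>k<L. \<forall>i. U (L * r + k) i \<omega> \<in> {a k i<..b k i})"
  have \<delta>: "0 < \<delta>" using pool_active(1) \<eta> not_unanimous by (simp add: \<delta>_def)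
  have L: "0 < L" by (simp add: L_def)
  have ab: "0 \<le> a k i" "\<delta> \<le> b k i - a k i" "b k i \<le> 1" for k i
    using \<eta> not_unanimous(1,2) by (auto simp: a_def b_def \<delta>_def)
  have "AE \<omega> in M. \<forall>r. Y r \<omega> \<longrightarrow> hitting_time X nash_band \<omega> \<le> of_nat (L * Suc r)"
    using AE_space pool_active(2) not_unanimous(3)
  proof (eventually_elim, intro allI impI)
    fix \<omega> r
    assume \<omega>: "\<omega> \<in> space M" and Y: "Y r \<omega>"
      and active: "\<forall>k. card (pool (snd (X k \<omega>))) > 0 \<longrightarrow>
         (\<exists>i\<in>pool (snd (X k \<omega>)). \<bar>fst (X (Suc k) \<omega>) $ i\<bar> \<ge> \<zeta>)"
      and hold: "\<forall>k. X k \<omega> \<notin> nash_band \<and> card (pool (snd (X k \<omega>))) = 0 \<longrightarrow>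
         (\<forall>i\<in>expensive_queue (snd (X k \<omega>)). \<bar>fst (X (Suc k) \<omega>) $ i\<bar> \<le> \<psi>)"
    let ?l = "\<lambda>t. snd (X t \<omega>)" and ?x = "\<lambda>t i. fst (X (Suc t) \<omega>) $ i" and ?u = "\<lambda>t i. U t i \<omega>"
    have loc: "?l t i \<in> {0, 1, -1}" for t i
      using in_state_space[OF \<omega>, of t] by (auto simp: state_space_def)
    have draw: "?u (L * r + k) i \<in> {a k i<..b k i}" if "k < L" for k i
      using Y that by (simp add: Y_def)
    have draw': "?u (L * r + ?N + j) i \<in> {a (?N + j) i<..b (?N + j) i}" if "j < ?N" for j i
      using draw[of "?N + j" i] that by (simp add: L_def add.assoc)
    have "pool (?l (L * r + ?N)) = {}"
    proof (rule pool_emptied)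
      show "\<exists>i\<in>pool (?l t). \<zeta> \<le> \<bar>?x t i\<bar>" if "pool (?l t) \<noteq> {}" for t
        using active that by (simp add: card_gt_0_iff)
      show "?u (L * r + j) i \<le> \<zeta>" if "j < ?N" for j i
        using draw[of j i] that by (simp add: L_def b_def)
    qed (rule location_update[OF \<omega>] pool_active(1))+
    then have "\<exists>j\<le>?N. pool (?l (L * r + ?N + j)) = {} \<and>
        \<bar>imbalance (?l (L * r + ?N + j))\<bar> \<le> nash_tolerance ?N"
    proof (rule queues_balanced[rotated 7])
      show "\<eta> \<le> - real_of_int s * ?x t i" if "s \<in> {1, -1}" "2 \<le> s * imbalance (?l t)" for t i s
      proof (rule oppose[OF opinion_update[OF \<omega>]])
        show "real_of_int s \<in> {1, -1}" using that(1) by auto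
        show "2 \<le> real_of_int s * real_of_int (imbalance (?l t))"
          using that(2) by (metis of_int_le_iff of_int_mult of_int_numeral)
      qed
      show "\<bar>?x t i\<bar> \<le> \<psi>" if "pool (?l t) = {}" "nash_tolerance ?N < \<bar>imbalance (?l t)\<bar>"
        "i \<in> expensive_queue (?l t)" for t i
      proof -
        have "X t \<omega> \<notin> nash_band" using that(2) by (auto simp: nash_band_def)
        then show ?thesis using hold that by simp
      qed
      show "?u (L * r + ?N + j) (e j) \<in> {0<..\<eta>}" if "j < ?N" for j
        using draw'[OF that, of "e j"] by (simp add: a_def b_def)
      show "\<psi> < ?u (L * r + ?N + j) i" if "j < ?N" "i \<noteq> e j" for j i
        using draw'[OF that(1), of i] that(2) by (simp add: a_def)
    qed (rule location_update[OF \<omega>] loc e \<eta>(1) not_unanimous(1))+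
    then obtain j where j: "j \<le> ?N" "pool (?l (L * r + ?N + j)) = {}"
      "\<bar>imbalance (?l (L * r + ?N + j))\<bar> \<le> nash_tolerance ?N"
      by blast
    let ?t = "L * r + ?N + j"
    have "X ?t \<omega> \<in> nash_band"
      using j in_state_space[OF \<omega>, of ?t] by (simp add: nash_band_def case_prod_beta)
    then have "hitting_time X nash_band \<omega> \<le> of_nat ?t"
      unfolding hitting_time_def by (intro INF_lower) simp
    also have "\<dots> \<le> of_nat (L * Suc r)"
      using j(1) by (intro of_nat_mono) (simp add: L_def)
    finally show "hitting_time X nash_band \<omega> \<le> of_nat (L * Suc r)" .
  qed
  moreover have "indep_vars (\<lambda>_. count_space UNIV) Y UNIV"
    unfolding Y_def by (rule draw_blocks(1)[OF \<delta> L ab])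
  moreover have "\<delta> ^ (L * ?N) \<le> prob {\<omega> \<in> space M. Y r \<omega>}" for r
    unfolding Y_def by (rule draw_blocks(2)[OF \<delta> L ab])
  moreover have "0 < \<delta> ^ (L * ?N)" using \<delta> by simp
  ultimately show ?thesis
    using L by (intro nn_integral_finite_if_geometric_tail[where Y = Y and L = L and p = "\<delta> ^ (L * ?N)"])
qed

end
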